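(* Let $\mathcal{H}$ be a separable infinite-dimensional Hilbert space with orthonormal basis $\{e_j\}_{j\in\mathbb{N}}$, and put $L_k:=\mathrm{span}\{e_1,\ldots,e_k\}$ for $k\in\mathbb{N}$. Let $W\in B(\mathcal{H})$ be invertible and let $U\in B(\mathcal{H})$ be unitary such that for each $k\in\mathbb{N}$ there exists $N_k\in\mathbb{N}$ with $U^n(L_k)\perp L_k$ for all $n\geq N_k$. Then the following statements are equivalent. (i) The operator $T_{U,W}$, $T_{U,W}(F)=WFU$, is hypercyclic on $B_0(\mathcal{H})$, where $B_0(\mathcal{H})$ is equipped with the operator norm. (ii) For each $m\in\mathbb{N}$ there exist a strictly increasing sequence $\{n_k\}$ in $\mathbb{N}$ and sequences $\{D_k\}$ and $\{G_k\}$ of operators in $B_0(\mathcal{H})$ such that $$\lim_{k\to\infty}\|D_k-P_m\|=\lim_{k\to\infty}\|G_k-P_m\|=0$$ and $$\lim_{k\to\infty}\|W^{n_k}G_k\|=\lim_{k\to\infty}\|W^{-n_k}D_k\|=0,$$ where $P_m$ denotes the orthogonal projection of $\mathcal{H}$ onto $L_m$.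
   Context: $B(\mathcal{H})$ is the space of bounded linear operators on $\mathcal{H}$ and $B_0(\mathcal{H})$ the subspace of compact operators. For $U,W\in B(\mathcal{H})$, $T_{U,W}(F):=WFU$, which maps $B_0(\mathcal{H})$ into itself. A bounded operator $T$ on a Banach space $\mathcal{X}$ is hypercyclic if there is $x\in\mathcal{X}$ such that $\{T^nx: n\in\mathbb{N}_0\}$ is dense in $\mathcal{X}$, where $\mathbb{N}_0=\mathbb{N}\cup\{0\}$. *)

theory Defs
  imports "HOL-Analysis.Analysis"
begin

(* Complex inner product spaces; the inner product is linear in its first argument.
   The class extends real_normed_vector so that the library's topology and its Banach space
   of bounded real-linear maps (type blinfun) with the operator norm are available.
   Some of the norm axioms inherited this way are redundant. *)

class complex_inner = real_normed_vector +
  fixes scaleC :: "complex \<Rightarrow> 'a \<Rightarrow> 'a"  (infixr \<open>*\<^sub>C\<close> 75)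
    and cinner :: "'a \<Rightarrow> 'a \<Rightarrow> complex"
  assumes scaleC_add_right: "a *\<^sub>C (x + y) = a *\<^sub>C x + a *\<^sub>C y"
    and scaleC_add_left: "(a + b) *\<^sub>C x = a *\<^sub>C x + b *\<^sub>C x"
    and scaleC_scaleC: "a *\<^sub>C (b *\<^sub>C x) = (a * b) *\<^sub>C x"
    and scaleC_one: "1 *\<^sub>C x = x"
    and scaleR_scaleC: "r *\<^sub>R x = complex_of_real r *\<^sub>C x"
    and cinner_commute: "cinner x y = cnj (cinner y x)"
    and cinner_add_left: "cinner (x + y) z = cinner x z + cinner y z"
    and cinner_scaleC_left: "cinner (a *\<^sub>C x) y = a * cinner x y"
    and cinner_nonneg: "0 \<le> Re (cinner x x)"
    and cinner_eq_zero_iff: "cinner x x = 0 \<longleftrightarrow> x = 0"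
    and norm_eq_sqrt_cinner: "norm x = sqrt (Re (cinner x x))"

class chilbert_space = complex_inner + complete_space

global_interpretation complex_vector: vector_space "scaleC :: complex \<Rightarrow> 'a \<Rightarrow> 'a::complex_inner"
  by unfold_locales
    (simp_all add: scaleC_add_right scaleC_add_left scaleC_scaleC scaleC_one)

abbreviation cspan :: "'a::complex_inner set \<Rightarrow> 'a set"
  where "cspan \<equiv> complex_vector.span"

definition orthonormal_basis :: "'i set \<Rightarrow> ('i \<Rightarrow> 'a::complex_inner) \<Rightarrow> bool"
  where "orthonormal_basis I e \<longleftrightarrow>
    (\<forall>i\<in>I. \<forall>j\<in>I. cinner (e i) (e j) = (if i = j then 1 else 0)) \<and>
    closure (cspan (e ` I)) = UNIV"

definition orthogonal_sets :: "'a::complex_inner set \<Rightarrow> 'a set \<Rightarrow> bool"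
  where "orthogonal_sets A B \<longleftrightarrow> (\<forall>x\<in>A. \<forall>y\<in>B. cinner x y = 0)"

definition bounded_ops :: "('a::complex_inner \<Rightarrow>\<^sub>L 'a) set"
  where "bounded_ops = {F :: 'a \<Rightarrow>\<^sub>L 'a. \<forall>c x. F (c *\<^sub>C x) = c *\<^sub>C F x}"

definition compact_ops :: "('a::complex_inner \<Rightarrow>\<^sub>L 'a) set"
  where "compact_ops = {F \<in> bounded_ops. compact (closure (blinfun_apply F ` cball 0 1))}"

definition op_power :: "('a::complex_inner \<Rightarrow>\<^sub>L 'a) \<Rightarrow> nat \<Rightarrow> 'a \<Rightarrow>\<^sub>L 'a"
  where "op_power W n = ((\<lambda>F. W o\<^sub>L F) ^^ n) id_blinfun"

definition is_inverse_op :: "('a::complex_inner \<Rightarrow>\<^sub>L 'a) \<Rightarrow> ('a \<Rightarrow>\<^sub>L 'a) \<Rightarrow> bool"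
  where "is_inverse_op W V \<longleftrightarrow> V \<in> bounded_ops \<and> V o\<^sub>L W = id_blinfun \<and> W o\<^sub>L V = id_blinfun"

definition invertible_op :: "('a::complex_inner \<Rightarrow>\<^sub>L 'a) \<Rightarrow> bool"
  where "invertible_op W \<longleftrightarrow> (\<exists>V. is_inverse_op W V)"

definition inverse_op :: "('a::complex_inner \<Rightarrow>\<^sub>L 'a) \<Rightarrow> 'a \<Rightarrow>\<^sub>L 'a"
  where "inverse_op W = (THE V. is_inverse_op W V)"

definition is_adjoint_op :: "('a::complex_inner \<Rightarrow>\<^sub>L 'a) \<Rightarrow> ('a \<Rightarrow>\<^sub>L 'a) \<Rightarrow> bool"
  where "is_adjoint_op U V \<longleftrightarrow> V \<in> bounded_ops \<and> (\<forall>x y. cinner (U x) y = cinner x (V y))"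

definition unitary_op :: "('a::complex_inner \<Rightarrow>\<^sub>L 'a) \<Rightarrow> bool"
  where "unitary_op U \<longleftrightarrow>
    U \<in> bounded_ops \<and> (\<exists>V. is_adjoint_op U V \<and> V o\<^sub>L U = id_blinfun \<and> U o\<^sub>L V = id_blinfun)"

definition is_orthogonal_projection :: "'a::complex_inner set \<Rightarrow> ('a \<Rightarrow>\<^sub>L 'a) \<Rightarrow> bool"
  where "is_orthogonal_projection M P \<longleftrightarrow> (\<forall>x. P x \<in> M \<and> orthogonal_sets {x - P x} M)"

definition orthogonal_projection :: "'a::complex_inner set \<Rightarrow> 'a \<Rightarrow>\<^sub>L 'a"
  where "orthogonal_projection M = (THE P. is_orthogonal_projection M P)"

(* X is the carrier of a subspace, with the norm of the ambient type, that T maps into itself;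
   the orbit then stays in X, so the inclusion below is density in X. *)
definition hypercyclic_on :: "'b::real_normed_vector set \<Rightarrow> ('b \<Rightarrow> 'b) \<Rightarrow> bool"
  where "hypercyclic_on X T \<longleftrightarrow> (\<exists>x\<in>X. X \<subseteq> closure {(T ^^ n) x | n. True})"

definition elem_op ::
    "('a::complex_inner \<Rightarrow>\<^sub>L 'a) \<Rightarrow> ('a \<Rightarrow>\<^sub>L 'a) \<Rightarrow> ('a \<Rightarrow>\<^sub>L 'a) \<Rightarrow> 'a \<Rightarrow>\<^sub>L 'a"
  where "elem_op U W F = W o\<^sub>L F o\<^sub>L U"

(* The descriptions above denote the intended operators. *)

lemma is_inverse_op_inverse_op:
  assumes "invertible_op W"
  shows "is_inverse_op W (inverse_op W)"
proof -
  obtain V where V: "is_inverse_op W V"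
    using assms unfolding invertible_op_def by blast
  have "V' = V" if "is_inverse_op W V'" for V'
  proof (rule blinfun_eqI)
    fix x
    have "blinfun_apply V' (blinfun_apply W (blinfun_apply V x)) = blinfun_apply V x"
      using that unfolding is_inverse_op_def
      by (metis blinfun_apply_blinfun_compose blinfun_apply_id_blinfun id_apply)
    moreover have "blinfun_apply W (blinfun_apply V x) = x"
      using V unfolding is_inverse_op_def
      by (metis blinfun_apply_blinfun_compose blinfun_apply_id_blinfun id_apply)
    ultimately show "blinfun_apply V' x = blinfun_apply V x" by simp
  qed
  with V show ?thesis
    unfolding inverse_op_def by (rule theI)
qed

lemma cinner_add_right: "cinner x (y + z) = cinner x y + cinner x z"
  by (metis cinner_add_left cinner_commute complex_cnj_add)

lemma cinner_scaleC_right: "cinner x (a *\<^sub>C y) = cnj a * cinner x y"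
  by (metis cinner_scaleC_left cinner_commute complex_cnj_mult)

lemma cinner_zero_left [simp]: "cinner 0 x = 0"
  by (metis add_cancel_right_right cinner_add_left)

lemma cinner_zero_right [simp]: "cinner x 0 = 0"
  by (metis add_cancel_right_right cinner_add_right)

lemma cinner_diff_left: "cinner (x - y) z = cinner x z - cinner y z"
  by (metis add_diff_cancel cinner_add_left diff_add_cancel)

lemma cinner_sum_left: "cinner (\<Sum>i\<in>A. f i) z = (\<Sum>i\<in>A. cinner (f i) z)"
  by (induction A rule: infinite_finite_induct) (simp_all add: cinner_add_left)

lemma is_orthogonal_projection_unique:
  assumes M: "complex_vector.subspace M"
    and P: "is_orthogonal_projection M P" and Q: "is_orthogonal_projection M Q"
  shows "P = Q"
proof (rule blinfun_eqI)
  fix x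
  let ?d = "blinfun_apply P x - blinfun_apply Q x"
  have d: "?d \<in> M"
    using P Q M by (simp add: is_orthogonal_projection_def complex_vector.subspace_diff)
  have "cinner (x - blinfun_apply Q x) ?d = 0" "cinner (x - blinfun_apply P x) ?d = 0"
    using P Q d by (auto simp: is_orthogonal_projection_def orthogonal_sets_def)
  then have "cinner ?d ?d = 0"
    by (simp add: cinner_diff_left)
  then show "blinfun_apply P x = blinfun_apply Q x"
    by (simp add: cinner_eq_zero_iff)
qed

lemma is_orthogonal_projection_span:
  assumes e: "orthonormal_basis I e" and A: "finite A" "A \<subseteq> I"
  shows "is_orthogonal_projection (cspan (e ` A)) (orthogonal_projection (cspan (e ` A)))"
proof -
  define p where "p x = (\<Sum>i\<in>A. cinner x (e i) *\<^sub>C e i)" for x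
  have in_span: "p x \<in> cspan (e ` A)" for x
    unfolding p_def
    by (intro complex_vector.span_sum complex_vector.span_scale complex_vector.span_base) auto
  have p_e: "cinner (p x) (e j) = cinner x (e j)" if "j \<in> A" for x j
  proof -
    have "cinner (p x) (e j) = (\<Sum>i\<in>A. if i = j then cinner x (e i) else 0)"
      unfolding p_def cinner_sum_left
    proof (rule sum.cong)
      fix i assume "i \<in> A"
      then have "cinner (e i) (e j) = (if i = j then 1 else 0)"
        using e A that unfolding orthonormal_basis_def by blast
      then show "cinner (cinner x (e i) *\<^sub>C e i) (e j) = (if i = j then cinner x (e i) else 0)"
        by (simp add: cinner_scaleC_left)
    qed simp
    with A that show ?thesis by simp
  qed
  have orth: "cinner (x - p x) y = 0" if "y \<in> cspan (e ` A)" for x y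
    using that
  proof (induction y rule: complex_vector.span_induct_alt)
    case base
    show ?case by simp
  next
    case (step c b y)
    then show ?case
      using p_e by (auto simp: cinner_add_right cinner_scaleC_right cinner_diff_left)
  qed
  have bl: "bounded_linear p"
  proof (rule bounded_linear_intro[where K = 1])
    show "p (x + y) = p x + p y" for x y
      by (simp add: p_def cinner_add_left scaleC_add_left sum.distrib)
    show "p (r *\<^sub>R x) = r *\<^sub>R p x" for r x
      by (simp add: p_def scaleR_scaleC cinner_scaleC_left
          complex_vector.scale_sum_right scaleC_scaleC)
    show "norm (p x) \<le> norm x * 1" for x
    proof -
      have 0: "cinner (x - p x) (p x) = 0"
        using orth in_span by blast
      then have 1: "cinner (p x) (x - p x) = 0"
        using cinner_commute[of "p x" "x - p x"] by simp
      have "cinner x x = cinner (p x + (x - p x)) (p x + (x - p x))"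
        by simp
      also have "\<dots> = cinner (p x) (p x) + cinner (x - p x) (x - p x)"
        using 0 1 by (simp only: cinner_add_left cinner_add_right) simp
      finally have "Re (cinner x x) = Re (cinner (p x) (p x)) + Re (cinner (x - p x) (x - p x))"
        by simp
      then show ?thesis
        using cinner_nonneg[of "x - p x"] by (simp add: norm_eq_sqrt_cinner)
    qed
  qed
  have P: "is_orthogonal_projection (cspan (e ` A)) (Blinfun p)"
    using in_span orth
    by (simp add: is_orthogonal_projection_def orthogonal_sets_def bounded_linear_Blinfun_apply[OF bl])
  then show ?thesis
    unfolding orthogonal_projection_def
    by (rule theI) (use P is_orthogonal_projection_unique complex_vector.subspace_span in blast)
qed

end

theory Submission
  imports Defs
begin

text \<open>Since the right factor \<open>U^n\<close> is isometric, it does not affect norms. If \<open>D\<close>, \<open>G\<close> are close to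
  \<open>P m\<close> and \<open>W^(-n) D\<close>, \<open>W^n G\<close> are small, then for compact \<open>F\<close>, \<open>H\<close> the operator
  \<open>X = G F + W^(-n) D H U^(-n)\<close> is close to \<open>P m F\<close> while its image \<open>W^n X U^n\<close> is close to \<open>P m H\<close>.
  As \<open>P m F\<close> tends to \<open>F\<close>, the map is topologically transitive on the separable Banach space of
  compact operators, and Baire's theorem applies.
  Conversely, let \<open>A\<close> and \<open>B = W^n A U^n\<close> be two points of a dense orbit near \<open>P m\<close>, with \<open>n\<close> so
  large that \<open>P m U^n P m = 0\<close>, hence also \<open>P m U^(-n) P m = 0\<close>. Then \<open>G = A P m\<close> and \<open>D = B P m\<close> work, because
  \<open>W^n G = (B - P m) U^(-n) P m\<close> and \<open>W^(-n) D = (A - P m) U^n P m\<close>.\<close>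

instance chilbert_space \<subseteq> banach ..

subsection \<open>Birkhoff transitivity\<close>

text \<open>The points of \<open>X\<close> whose orbit enters a given ball form an open subset of
  \<open>X\<close>, which transitivity makes dense when the ball meets \<open>X\<close> well inside.
  Countably many balls with centres in \<open>C\<close> suffice to test density, so Baire's theorem
  yields one point whose orbit enters all of them. Working in a closed set \<open>X\<close> instead
  of a whole type lets the compact operators serve as the space.\<close>

lemma Birkhoff_transitivity:
  fixes T :: "'b::{real_normed_vector,complete_space} \<Rightarrow> 'b"
  assumes X: "closed X" "X \<noteq> {}"
    and T: "continuous_on X T" "T ` X \<subseteq> X"
    and C: "countable C" "X \<subseteq> closure C"
    and trans: "\<And>x y \<epsilon>. x \<in> X \<Longrightarrow> y \<in> X \<Longrightarrow> \<epsilon> > 0 \<Longrightarrow>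
      \<exists>z\<in>X. \<exists>n. dist z x < \<epsilon> \<and> dist ((T ^^ n) z) y < \<epsilon>"
  shows "hypercyclic_on X T"
proof -
  interpret S: Submetric UNIV dist X
    by unfold_locales auto
  have top: "S.sub.mtopology = top_of_set X"
    by (simp add: S.mtopology_submetric)
  have complete: "S.sub.mcomplete"
    by (rule S.closedin_mcomplete_imp_mcomplete)
      (use X in \<open>simp_all add: complete_UNIV\<close>)
  have iter: "continuous_on X (T ^^ n) \<and> (T ^^ n) ` X \<subseteq> X" for n
  proof (induction n)
    case (Suc n)
    then show ?case
      using T by (auto intro!: continuous_on_compose2[of X T X "T ^^ n"])
  qed auto
  define G where "G c q = {x \<in> X. \<exists>n. dist ((T ^^ n) x) c < inverse (real (Suc q))}" for c q
  \<comment> \<open>\<open>C\<close> may lie outside \<open>X\<close>, so a ball around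
    \<open>c\<close> can miss \<open>X\<close> and leave \<open>G c q\<close> empty. Only balls with
    a point of \<open>X\<close> within half the radius are kept; the other half absorbs the error in
    the transitivity property.\<close>
  define CX where "CX = {(c, q). c \<in> C \<and> (\<exists>y\<in>X. dist y c < inverse (real (Suc q)) / 2)}"
  define \<G> where "\<G> = (\<lambda>(c, q). G c q) ` CX"
  have "countable CX"
    by (rule countable_subset[of _ "C \<times> UNIV"]) (auto simp: CX_def C)
  then have "countable \<G>"
    by (simp add: \<G>_def)
  have "openin (top_of_set X) (G c q)" for c q
  proof -
    have "G c q = (\<Union>n. X \<inter> (T ^^ n) -` ball c (inverse (real (Suc q))))"
      by (auto simp: G_def dist_commute)
    also have "openin (top_of_set X) \<dots>"
      using iter by (intro openin_Union) (auto intro: continuous_openin_preimage_gen)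
    finally show ?thesis .
  qed
  moreover have "top_of_set X closure_of G c q = X" if cq: "(c, q) \<in> CX" for c q
  proof -
    define r where "r = inverse (real (Suc q))"
    obtain y where y: "y \<in> X" "dist y c < r / 2"
      using cq by (auto simp: CX_def r_def)
    have "x \<in> closure (G c q)" if x: "x \<in> X" for x
      unfolding closure_approachable
    proof (intro allI impI)
      fix \<epsilon> :: real assume "\<epsilon> > 0"
      moreover have "r > 0" by (simp add: r_def)
      ultimately obtain z n where z: "z \<in> X" "dist z x < min \<epsilon> (r / 2)"
        "dist ((T ^^ n) z) y < min \<epsilon> (r / 2)"
        using trans[OF x y(1), of "min \<epsilon> (r / 2)"] by auto
      have "dist ((T ^^ n) z) c < r"
        using dist_triangle[of "(T ^^ n) z" c y] z y by simp
      then have "z \<in> G c q"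
        using z by (auto simp: G_def r_def)
      then show "\<exists>y\<in>G c q. dist y x < \<epsilon>"
        using z by auto
    qed
    moreover have "G c q \<subseteq> X" by (auto simp: G_def)
    ultimately show ?thesis
      by (auto simp: closure_of_subtopology Int_absorb1)
  qed
  ultimately have "openin (top_of_set X) S \<and> top_of_set X closure_of S = X" if "S \<in> \<G>" for S
    using that by (auto simp: \<G>_def)
  then have "top_of_set X closure_of \<Inter>\<G> = X"
    using S.sub.metric_Baire_category[OF complete \<open>countable \<G>\<close>] unfolding top by blast
  then obtain x0 where x0: "x0 \<in> \<Inter>\<G>"
    using X by (metis all_not_in_conv closure_of_empty)
  \<comment> \<open>The intersection of the empty family is the whole type, so
    \<open>x0 \<in> X\<close> is derived from at least one \<open>G c q\<close> in
    \<open>\<G>\<close>.\<close>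
  have "CX \<noteq> {}"
  proof -
    obtain y where "y \<in> X" using X by blast
    then obtain c where "c \<in> C" "dist c y < inverse (real (Suc 0)) / 2"
      using C unfolding closure_approachable subset_iff by (metis half_gt_zero inverse_positive_iff_positive of_nat_0_less_iff zero_less_Suc)
    then have "(c, 0) \<in> CX"
      using \<open>y \<in> X\<close> by (auto simp: CX_def dist_commute)
    then show ?thesis by blast
  qed
  then have "x0 \<in> X"
    using x0 by (auto simp: \<G>_def G_def)
  moreover have "y \<in> closure {(T ^^ n) x0 | n. True}" if y: "y \<in> X" for y
    unfolding closure_approachable
  proof (intro allI impI)
    fix \<epsilon> :: real assume "\<epsilon> > 0"
    then obtain q where q: "inverse (real (Suc q)) < \<epsilon> / 2"
      using reals_Archimedean half_gt_zero by blast
    define r where "r = inverse (real (Suc q))"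
    have "r > 0" by (simp add: r_def)
    then obtain c where c: "c \<in> C" "dist c y < r / 2"
      using C y unfolding closure_approachable subset_iff by (metis half_gt_zero)
    then have "(c, q) \<in> CX"
      using y by (auto simp: CX_def dist_commute r_def)
    then have "x0 \<in> G c q"
      using x0 by (auto simp: \<G>_def)
    then obtain n where "dist ((T ^^ n) x0) c < r"
      by (auto simp: G_def r_def)
    then have "dist ((T ^^ n) x0) y < \<epsilon>"
      using dist_triangle[of "(T ^^ n) x0" y c] c(2) q[folded r_def] \<open>r > 0\<close> by linarith
    then show "\<exists>x\<in>{(T ^^ n) x0 | n. True}. dist x y < \<epsilon>"
      by blast
  qed
  ultimately show ?thesis
    unfolding hypercyclic_on_def by blast
qed

text \<open>Finitely many returns to the ball would make the closure of the orbit inside that ball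
  finite, whereas the points \<open>(1 + t) *\<^sub>R y\<close> with small \<open>t > 0\<close> form
  an infinite set inside both. Infinitely many returns provide two return times that are as far
  apart as desired.\<close>

lemma hypercyclic_orbit_infinitely_close:
  fixes T :: "'b::real_normed_vector \<Rightarrow> 'b"
  assumes x: "X \<subseteq> closure {(T ^^ n) x | n. True}"
    and y: "y \<noteq> 0" "\<And>r. r *\<^sub>R y \<in> X" and "\<epsilon> > 0"
  shows "infinite {n. dist ((T ^^ n) x) y < \<epsilon>}"
proof
  let ?J = "{n. dist ((T ^^ n) x) y < \<epsilon>}"
  assume "finite ?J"
  define S where "S = (\<lambda>n. (T ^^ n) x) ` ?J"
  have "finite S" using \<open>finite ?J\<close> by (simp add: S_def)
  \<comment> \<open>A limit of the orbit that lies in the open ball is a limit of orbit points in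
    the ball, and these form the finite, hence closed, set \<open>S\<close>.\<close>
  have "ball y \<epsilon> \<inter> closure {(T ^^ n) x | n. True}
      \<subseteq> closure (ball y \<epsilon> \<inter> {(T ^^ n) x | n. True})"
    by (rule open_Int_closure_subset) simp
  also have "\<dots> \<subseteq> S"
    using \<open>finite S\<close>
    by (intro closure_minimal finite_imp_closed) (auto simp: S_def dist_commute)
  finally have *: "ball y \<epsilon> \<inter> closure {(T ^^ n) x | n. True} \<subseteq> S" .
  have "(\<lambda>t. (1 + t) *\<^sub>R y) ` {0<..<\<epsilon> / norm y} \<subseteq> S"
  proof (rule image_subsetI)
    fix t assume t: "t \<in> {0<..<\<epsilon> / norm y}"
    have "dist y ((1 + t) *\<^sub>R y) = t * norm y"
      using t by (simp add: dist_norm scaleR_left_distrib)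
    also have "\<dots> < \<epsilon>"
      using t y by (simp add: pos_less_divide_eq)
    finally show "(1 + t) *\<^sub>R y \<in> S"
      using * x y(2)[of "1 + t"] by auto
  qed
  moreover have "inj_on (\<lambda>t. (1 + t) *\<^sub>R y) {0<..<\<epsilon> / norm y}"
    using y by (auto simp: inj_on_def)
  ultimately have "finite {0<..<\<epsilon> / norm y}"
    using \<open>finite S\<close> finite_imageD finite_subset by blast
  moreover have "0 < \<epsilon> / norm y" using y \<open>\<epsilon> > 0\<close> by simp
  ultimately show False
    using infinite_Ioo by blast
qed

subsection \<open>Geometry of complex inner product spaces\<close>

lemma cinner_self: "cinner x x = complex_of_real ((norm x)\<^sup>2)"
proof -
  have "Im (cinner x x) = 0"
    using cinner_commute[of x x] by (metis cnj.simps(2) equal_neg_zero)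
  then show ?thesis
    by (simp add: complex_eq_iff norm_eq_sqrt_cinner cinner_nonneg)
qed

lemma norm_power2_eq_Re_cinner: "(norm x)\<^sup>2 = Re (cinner x x)"
  by (simp add: cinner_self)

lemma cinner_sum_right: "cinner z (\<Sum>i\<in>A. f i) = (\<Sum>i\<in>A. cinner z (f i))"
  by (induction A rule: infinite_finite_induct) (simp_all add: cinner_add_right)

lemma cinner_scaleR_left: "cinner (r *\<^sub>R x) y = r *\<^sub>R cinner x y"
  by (simp add: scaleR_scaleC cinner_scaleC_left scaleR_conv_of_real)

lemma cinner_eq_zero_commute: "cinner x y = 0 \<longleftrightarrow> cinner y x = 0"
  by (metis cinner_commute complex_cnj_zero)

lemma norm_scaleC: "norm (c *\<^sub>C x) = cmod c * norm x"
proof -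
  have "cinner (c *\<^sub>C x) (c *\<^sub>C x) = (c * cnj c) * cinner x x"
    by (simp add: cinner_scaleC_left cinner_scaleC_right)
  also have "\<dots> = complex_of_real ((cmod c * norm x)\<^sup>2)"
    by (simp only: cinner_self complex_norm_square[symmetric] power_mult_distrib of_real_mult)
  finally have "(norm (c *\<^sub>C x))\<^sup>2 = (cmod c * norm x)\<^sup>2"
    by (simp only: cinner_self of_real_eq_iff)
  then show ?thesis
    by (simp add: power2_eq_iff_nonneg)
qed

text \<open>Subtracting from \<open>x\<close> its component \<open>c *\<^sub>C y\<close> along
  \<open>y\<close> leaves a vector \<open>z\<close> orthogonal to \<open>y\<close>. Pythagoras then
  gives \<open>cmod c * norm y \<le> norm x\<close>, and multiplication by \<open>norm y\<close>
  gives the claim.\<close>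

lemma Cauchy_Schwarz_cinner: "cmod (cinner x y) \<le> norm x * norm y"
proof (cases "y = 0")
  case False
  define c where "c = cinner x y / cinner y y"
  have yy: "cinner y y \<noteq> 0" using False by (simp add: cinner_eq_zero_iff)
  define z where "z = x - c *\<^sub>C y"
  have zy: "cinner z y = 0"
    using yy by (simp add: z_def c_def cinner_diff_left cinner_scaleC_left)
  then have yz: "cinner y z = 0"
    by (simp add: cinner_eq_zero_commute)
  have x: "x = z + c *\<^sub>C y" by (simp add: z_def)
  have "cinner x x = cinner z z + cinner (c *\<^sub>C y) (c *\<^sub>C y)"
    by (subst (1 2) x) (simp only: cinner_add_left cinner_add_right cinner_scaleC_left
        cinner_scaleC_right zy yz, simp)
  then have "(norm x)\<^sup>2 = (norm z)\<^sup>2 + (cmod c * norm y)\<^sup>2"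
    by (simp add: norm_power2_eq_Re_cinner flip: norm_scaleC)
  then have "cmod c * norm y \<le> norm x"
    by (metis norm_ge_zero power2_le_imp_le le_add_same_cancel2 zero_le_power2)
  moreover have "cinner x y = c * cinner y y"
    using yy by (simp add: c_def)
  then have "cmod (cinner x y) = cmod c * norm y * norm y"
    by (simp add: cinner_self norm_mult power2_eq_square)
  ultimately show ?thesis
    by (metis mult_right_mono norm_ge_zero)
qed simp

lemma bounded_linear_scaleC_left: "bounded_linear (\<lambda>c. c *\<^sub>C x)"
  by (rule bounded_linear_intro[where K = "norm x"])
    (simp_all add: scaleC_add_left scaleR_scaleC scaleC_scaleC norm_scaleC scaleR_conv_of_real)

lemma bounded_linear_scaleC_right: "bounded_linear (\<lambda>x. c *\<^sub>C x)"
  by (rule bounded_linear_intro[where K = "cmod c"])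
    (simp_all add: scaleC_add_right scaleR_scaleC scaleC_scaleC norm_scaleC mult.commute)

lemma bounded_linear_cinner_left: "bounded_linear (\<lambda>x. cinner x y)"
  by (rule bounded_linear_intro[where K = "norm y"])
    (simp_all add: cinner_add_left cinner_scaleR_left Cauchy_Schwarz_cinner)

subsection \<open>Bounded and compact operators\<close>

lemma bounded_ops_blinfun_compose:
  "A \<in> bounded_ops \<Longrightarrow> B \<in> bounded_ops \<Longrightarrow> A o\<^sub>L B \<in> bounded_ops"
  by (simp add: bounded_ops_def)

lemma bounded_ops_id: "id_blinfun \<in> bounded_ops"
  by (simp add: bounded_ops_def)

lemma bounded_ops_add: "A \<in> bounded_ops \<Longrightarrow> B \<in> bounded_ops \<Longrightarrow> A + B \<in> bounded_ops"
  by (simp add: bounded_ops_def blinfun.add_left scaleC_add_right)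

text \<open>A subset of a compact set has compact closure. Exhibiting any compact superset avoids
  handling closures of sums and images of sets.\<close>

lemma compact_ops_iff:
  fixes F :: "'a::complex_inner \<Rightarrow>\<^sub>L 'a"
  shows "F \<in> compact_ops \<longleftrightarrow>
    F \<in> bounded_ops \<and> (\<exists>K. compact K \<and> blinfun_apply F ` cball 0 1 \<subseteq> K)"
proof -
  have "compact (closure S) \<longleftrightarrow> (\<exists>K. compact K \<and> S \<subseteq> K)" for S :: "'a set"
    by (metis closed_closure closure_minimal closure_subset compact_Int_closed compact_imp_closed
        inf.absorb_iff2)
  then show ?thesis
    by (simp add: compact_ops_def)
qed

lemma compact_ops_bounded: "F \<in> compact_ops \<Longrightarrow> F \<in> bounded_ops"
  by (simp add: compact_ops_def)

lemma compact_ops_zero: "0 \<in> compact_ops"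
  unfolding compact_ops_iff by (auto simp: bounded_ops_def intro!: exI[of _ "{0}"])

lemma compact_ops_add:
  assumes "A \<in> compact_ops" "B \<in> compact_ops"
  shows "A + B \<in> compact_ops"
proof -
  obtain K L where "compact K" "blinfun_apply A ` cball 0 1 \<subseteq> K"
    "compact L" "blinfun_apply B ` cball 0 1 \<subseteq> L"
    using assms by (auto simp: compact_ops_iff)
  then have "compact {x + y |x y. x \<in> K \<and> y \<in> L}"
    "blinfun_apply (A + B) ` cball 0 1 \<subseteq> {x + y |x y. x \<in> K \<and> y \<in> L}"
    by (simp_all add: compact_sums image_subset_iff blinfun.add_left) blast
  then show ?thesis
    using assms bounded_ops_add unfolding compact_ops_iff by blast
qed

lemma compact_ops_sum: "(\<And>i. i \<in> A \<Longrightarrow> f i \<in> compact_ops) \<Longrightarrow> sum f A \<in> compact_ops"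
  by (induction A rule: infinite_finite_induct) (auto simp: compact_ops_zero compact_ops_add)

lemma compact_ops_compose_left:
  assumes "A \<in> bounded_ops" "F \<in> compact_ops"
  shows "A o\<^sub>L F \<in> compact_ops"
proof -
  obtain K where "compact K" "blinfun_apply F ` cball 0 1 \<subseteq> K"
    using assms by (auto simp: compact_ops_iff)
  moreover from this have "compact (blinfun_apply A ` K)"
    by (intro compact_continuous_image linear_continuous_on blinfun.bounded_linear_right)
  ultimately show ?thesis
    using assms bounded_ops_blinfun_compose compact_ops_bounded unfolding compact_ops_iff
    by (auto intro!: exI[of _ "blinfun_apply A ` K"])
qed

lemma compact_ops_compose_right:
  assumes "A \<in> bounded_ops" "F \<in> compact_ops"
  shows "F o\<^sub>L A \<in> compact_ops"
proof -
  obtain K where K: "compact K" "blinfun_apply F ` cball 0 1 \<subseteq> K"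
    using assms by (auto simp: compact_ops_iff)
  \<comment> \<open>\<open>A\<close> maps the unit ball into the ball of radius \<open>r\<close>, so
    the composition maps it into \<open>K\<close> scaled by \<open>r\<close>. Adding 1 keeps
    \<open>r\<close> positive even for \<open>A = 0\<close>.\<close>
  define r where "r = norm A + 1"
  have r: "r > 0" by (simp add: r_def add_nonneg_pos)
  have "F (A x) \<in> (\<lambda>y. r *\<^sub>R y) ` K" if "norm x \<le> 1" for x
  proof -
    have "norm (A x) \<le> norm A * 1"
      using norm_blinfun[of A x] that by (meson mult_left_mono norm_ge_zero order_trans)
    then have "norm (A x) \<le> r" by (simp add: r_def)
    then have "(1 / r) *\<^sub>R A x \<in> cball 0 1"
      using r by (simp add: divide_simps)
    then have "F ((1 / r) *\<^sub>R A x) \<in> K" using K by blast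
    moreover have "F (A x) = r *\<^sub>R F ((1 / r) *\<^sub>R A x)"
      using r by (simp add: blinfun.scaleR_right)
    ultimately show ?thesis by blast
  qed
  moreover have "compact ((\<lambda>y. r *\<^sub>R y) ` K)"
    using K by (simp add: compact_scaling)
  ultimately show ?thesis
    using assms bounded_ops_blinfun_compose compact_ops_bounded unfolding compact_ops_iff
    by (auto intro!: exI[of _ "(\<lambda>y. r *\<^sub>R y) ` K"])
qed

lemma compact_ops_scaleR:
  assumes "F \<in> compact_ops"
  shows "r *\<^sub>R F \<in> compact_ops"
proof -
  have "r *\<^sub>R id_blinfun \<in> bounded_ops"
    by (simp add: bounded_ops_def blinfun.scaleR_left scaleR_scaleC scaleC_scaleC mult.commute)
  moreover have "r *\<^sub>R F = (r *\<^sub>R id_blinfun) o\<^sub>L F"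
    by (rule blinfun_eqI) (simp add: blinfun.scaleR_left)
  ultimately show ?thesis
    using compact_ops_compose_left assms by metis
qed

section \<open>Total boundedness and closedness of the set of compact operators\<close>

lemma compact_ops_finite_net:
  assumes "F \<in> compact_ops" "\<epsilon> > 0"
  shows "\<exists>k. finite k \<and> blinfun_apply F ` cball 0 1 \<subseteq> (\<Union>y\<in>k. ball y \<epsilon>)"
proof -
  obtain K where "compact K" "blinfun_apply F ` cball 0 1 \<subseteq> K"
    using assms by (auto simp: compact_ops_iff)
  then show ?thesis
    using assms(2) unfolding compact_eq_totally_bounded by (meson subset_trans)
qed

text \<open>In a complete space, total boundedness of the image makes its closure compact. A finite
  union of closed balls of half the radius is closed, so a cover of the image also covers its
  closure.\<close>

lemma compact_ops_finite_netI:
  fixes F :: "'a::chilbert_space \<Rightarrow>\<^sub>L 'a"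
  assumes "F \<in> bounded_ops"
    and net: "\<And>\<epsilon>. \<epsilon> > 0 \<Longrightarrow> \<exists>k. finite k \<and> blinfun_apply F ` cball 0 1 \<subseteq> (\<Union>y\<in>k. ball y \<epsilon>)"
  shows "F \<in> compact_ops"
proof -
  have "compact (closure (blinfun_apply F ` cball 0 1))"
    unfolding compact_eq_totally_bounded
  proof (intro conjI allI impI)
    show "complete (closure (blinfun_apply F ` cball 0 1))"
      by (simp add: complete_eq_closed)
    fix \<epsilon> :: real assume "\<epsilon> > 0"
    then obtain k where k: "finite k" "blinfun_apply F ` cball 0 1 \<subseteq> (\<Union>y\<in>k. ball y (\<epsilon> / 2))"
      using net half_gt_zero by blast
    then have "blinfun_apply F ` cball 0 1 \<subseteq> (\<Union>y\<in>k. cball y (\<epsilon> / 2))"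
      using ball_subset_cball by blast
    then have "closure (blinfun_apply F ` cball 0 1) \<subseteq> (\<Union>y\<in>k. cball y (\<epsilon> / 2))"
      using k by (intro closure_minimal) (auto intro: closed_UN)
    also have "\<dots> \<subseteq> (\<Union>y\<in>k. ball y \<epsilon>)"
      using \<open>\<epsilon> > 0\<close> by fastforce
    finally show "\<exists>k. finite k \<and> closure (blinfun_apply F ` cball 0 1) \<subseteq> (\<Union>y\<in>k. ball y \<epsilon>)"
      using k by blast
  qed
  with assms(1) show ?thesis
    by (simp add: compact_ops_def)
qed

lemma closed_bounded_ops: "closed (bounded_ops :: ('a::complex_inner \<Rightarrow>\<^sub>L 'a) set)"
proof -
  have "bounded_ops = (\<Inter>c. \<Inter>x. {F :: 'a \<Rightarrow>\<^sub>L 'a. F (c *\<^sub>C x) = c *\<^sub>C F x})"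
    by (auto simp: bounded_ops_def)
  moreover have "closed {F :: 'a \<Rightarrow>\<^sub>L 'a. F (c *\<^sub>C x) = c *\<^sub>C F x}" for c x
    by (intro closed_Collect_eq continuous_intros
        bounded_linear.continuous_on[OF bounded_linear_scaleC_right])
  ultimately show ?thesis
    by (metis (no_types, lifting) closed_INT)
qed

text \<open>A finite net for the image under a nearby compact operator \<open>G\<close> is, with
  doubled radius, a net for the image under \<open>F\<close>. Closedness makes the compact operators
  a complete space, to which Baire's theorem applies.\<close>

lemma closed_compact_ops: "closed (compact_ops :: ('a::chilbert_space \<Rightarrow>\<^sub>L 'a) set)"
proof (subst closure_subset_eq[symmetric], rule subsetI)
  fix F :: "'a \<Rightarrow>\<^sub>L 'a"
  assume F: "F \<in> closure compact_ops"
  show "F \<in> compact_ops"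
  proof (rule compact_ops_finite_netI)
    show "F \<in> bounded_ops"
      using F closure_minimal[OF _ closed_bounded_ops] compact_ops_bounded by blast
    fix \<epsilon> :: real assume \<epsilon>: "\<epsilon> > 0"
    then obtain G where G: "G \<in> compact_ops" "dist G F < \<epsilon> / 2"
      using F half_gt_zero unfolding closure_approachable by blast
    then obtain k where k: "finite k" "blinfun_apply G ` cball 0 1 \<subseteq> (\<Union>y\<in>k. ball y (\<epsilon> / 2))"
      using compact_ops_finite_net \<epsilon> half_gt_zero by metis
    have "blinfun_apply F ` cball 0 1 \<subseteq> (\<Union>y\<in>k. ball y \<epsilon>)"
    proof clarsimp
      fix x :: 'a assume x: "norm x \<le> 1"
      then obtain y where y: "y \<in> k" "dist y (G x) < \<epsilon> / 2"
        using k(2) by (fastforce simp del: less_divide_eq_numeral1)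
      have "norm ((G - F) x) \<le> norm (G - F) * 1"
        using norm_blinfun[of "G - F" x] x by (meson mult_left_mono norm_ge_zero order_trans)
      then have "dist (G x) (F x) < \<epsilon> / 2"
        using G(2) by (simp add: dist_norm blinfun.diff_left)
      then have "dist y (F x) < \<epsilon>"
        using dist_triangle[of y "F x" "G x"] y by simp
      then show "\<exists>y\<in>k. dist y (F x) < \<epsilon>" using y by blast
    qed
    with k show "\<exists>k. finite k \<and> blinfun_apply F ` cball 0 1 \<subseteq> (\<Union>y\<in>k. ball y \<epsilon>)"
      by blast
  qed
qed

subsection \<open>Rank-one operators\<close>

text \<open>The elementary tensor of \<open>a\<close> with the functional given by \<open>b\<close>.
  It is conjugate-linear in \<open>b\<close>, since the inner product is linear in its first
  argument.\<close>

definition rank_one :: "'a::complex_inner \<Rightarrow> 'a \<Rightarrow> 'a \<Rightarrow>\<^sub>L 'a"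
  where "rank_one a b = Blinfun (\<lambda>x. cinner x b *\<^sub>C a)"

lemma rank_one_apply [simp]: "rank_one a b x = cinner x b *\<^sub>C a"
  unfolding rank_one_def
  by (subst bounded_linear_Blinfun_apply[OF bounded_linear_compose[OF
        bounded_linear_scaleC_left bounded_linear_cinner_left]]) simp

lemma rank_one_diff_left: "rank_one a b - rank_one c b = rank_one (a - c) b"
  by (rule blinfun_eqI) (simp add: blinfun.diff_left complex_vector.scale_right_diff_distrib)

lemma norm_rank_one_le: "norm (rank_one a b) \<le> norm a * norm b"
proof (rule norm_blinfun_bound)
  fix x
  have "cmod (cinner x b) * norm a \<le> (norm x * norm b) * norm a"
    by (rule mult_right_mono[OF Cauchy_Schwarz_cinner]) simp
  then show "norm (rank_one a b x) \<le> norm a * norm b * norm x"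
    by (simp add: norm_scaleC mult_ac)
qed simp

text \<open>By Cauchy-Schwarz the unit ball is sent to multiples of \<open>a\<close> with
  coefficients in the disc of radius \<open>norm b\<close>, a continuous image of a compact
  disc.\<close>

lemma rank_one_compact_ops: "rank_one a b \<in> compact_ops"
proof -
  have "compact ((\<lambda>c. c *\<^sub>C a) ` cball 0 (norm b))"
    by (intro compact_continuous_image linear_continuous_on bounded_linear_scaleC_left) simp
  moreover have "rank_one a b ` cball 0 1 \<subseteq> (\<lambda>c. c *\<^sub>C a) ` cball 0 (norm b)"
  proof clarsimp
    fix x :: 'a assume "norm x \<le> 1"
    then have "norm x * norm b \<le> norm b"
      by (simp add: mult_left_le_one_le)
    then have "cmod (cinner x b) \<le> norm b"
      using Cauchy_Schwarz_cinner order_trans by blast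
    then show "cinner x b *\<^sub>C a \<in> (\<lambda>c. c *\<^sub>C a) ` cball 0 (norm b)"
      by (intro imageI) simp
  qed
  moreover have "rank_one a b \<in> bounded_ops"
    by (simp add: bounded_ops_def cinner_scaleC_left scaleC_scaleC)
  ultimately show ?thesis
    unfolding compact_ops_iff by blast
qed

lemma blinfun_apply_sum: "blinfun_apply (sum f A) x = (\<Sum>i\<in>A. f i x)"
  by (induction A rule: infinite_finite_induct) (simp_all add: blinfun.add_left)

subsection \<open>Projections onto the span of a part of the basis\<close>

locale orthonormal_sequence =
  fixes e :: "nat \<Rightarrow> 'a::chilbert_space"
  assumes basis: "orthonormal_basis {1..} e"
begin

definition proj :: "nat \<Rightarrow> 'a \<Rightarrow>\<^sub>L 'a"
  where "proj m = orthogonal_projection (cspan (e ` {1..m}))"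

lemma cinner_basis: "1 \<le> i \<Longrightarrow> 1 \<le> j \<Longrightarrow> cinner (e i) (e j) = (if i = j then 1 else 0)"
  using basis by (simp add: orthonormal_basis_def)

lemma norm_basis: "1 \<le> i \<Longrightarrow> norm (e i) = 1"
  by (simp add: norm_eq_sqrt_cinner cinner_basis)

lemma cinner_sum_basis:
  assumes "finite A" "A \<subseteq> {1..}" "1 \<le> j"
  shows "cinner (\<Sum>i\<in>A. c i *\<^sub>C e i) (e j) = (if j \<in> A then c j else 0)"
proof -
  have "cinner (\<Sum>i\<in>A. c i *\<^sub>C e i) (e j) = (\<Sum>i\<in>A. if i = j then c i else 0)"
    unfolding cinner_sum_left
    using assms by (intro sum.cong) (auto simp: cinner_scaleC_left cinner_basis subset_iff)
  with assms show ?thesis by simp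
qed

lemma proj_in_span: "proj m x \<in> cspan (e ` {1..m})"
  and proj_orth: "y \<in> cspan (e ` {1..m}) \<Longrightarrow> cinner (x - proj m x) y = 0"
  using is_orthogonal_projection_span[OF basis, of "{1..m}"]
  by (auto simp: proj_def is_orthogonal_projection_def orthogonal_sets_def)

lemma span_expansion:
  assumes "y \<in> cspan (e ` {1..m})"
  shows "y = (\<Sum>i = 1..m. cinner y (e i) *\<^sub>C e i)"
  using assms
proof (induction y rule: complex_vector.span_induct_alt)
  case (step c b y)
  then obtain j where j: "b = e j" "j \<in> {1..m}" by blast
  have "(\<Sum>i = 1..m. cinner b (e i) *\<^sub>C e i) = (\<Sum>i = 1..m. if i = j then e i else 0)"
    using j by (intro sum.cong) (auto simp: cinner_basis scaleC_one)
  also have "\<dots> = b" using j by simp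
  finally have "b = (\<Sum>i = 1..m. cinner b (e i) *\<^sub>C e i)" ..
  then have "c *\<^sub>C b = (\<Sum>i = 1..m. cinner (c *\<^sub>C b) (e i) *\<^sub>C e i)"
    by (metis (no_types, lifting) cinner_scaleC_left complex_vector.scale_sum_right scaleC_scaleC sum.cong)
  then show ?case
    using step.IH by (simp add: cinner_add_left scaleC_add_left sum.distrib)
qed simp

lemma proj_apply: "proj m x = (\<Sum>i = 1..m. cinner x (e i) *\<^sub>C e i)"
proof -
  have "cinner (proj m x) (e i) = cinner x (e i)" if "i \<in> {1..m}" for i
  proof -
    have "e i \<in> cspan (e ` {1..m})"
      using that by (intro complex_vector.span_base) simp
    from proj_orth[OF this, of x] show ?thesis
      by (simp add: cinner_diff_left)
  qed
  then show ?thesis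
    using span_expansion[OF proj_in_span, of m x] by simp
qed

lemma proj_eq_sum_rank_one: "proj m = (\<Sum>i = 1..m. rank_one (e i) (e i))"
  by (rule blinfun_eqI) (simp add: proj_apply blinfun_apply_sum)

lemma proj_compact_ops: "proj m \<in> compact_ops"
  unfolding proj_eq_sum_rank_one by (intro compact_ops_sum rank_one_compact_ops)

lemma proj_span: "y \<in> cspan (e ` {1..m}) \<Longrightarrow> proj m y = y"
  using span_expansion by (simp add: proj_apply)

lemma proj_basis: "1 \<le> j \<Longrightarrow> j \<le> m \<Longrightarrow> proj m (e j) = e j"
  by (intro proj_span complex_vector.span_base) simp

lemma proj_proj: "proj m (proj m x) = proj m x"
  by (intro proj_span proj_in_span)

lemma proj_eq_0:
  assumes "\<And>y. y \<in> cspan (e ` {1..m}) \<Longrightarrow> cinner x y = 0"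
  shows "proj m x = 0"
  using assms by (simp add: proj_apply complex_vector.span_base)

lemma norm_proj_apply_le: "norm (proj m x) \<le> norm x"
proof (cases "proj m x = 0")
  case False
  have "cinner (proj m x) (proj m x) = cinner x (proj m x)"
    using proj_orth[OF proj_in_span, of x] by (simp add: cinner_diff_left)
  then have "norm (proj m x) * norm (proj m x) = cmod (cinner x (proj m x))"
    by (metis cinner_self norm_ge_zero norm_of_real power2_eq_square abs_of_nonneg zero_le_power2)
  also have "\<dots> \<le> norm x * norm (proj m x)"
    by (rule Cauchy_Schwarz_cinner)
  finally show ?thesis
    using False by simp
qed simp

text \<open>Since projections are contractions, moving the point changes the approximation error by
  at most twice the displacement, uniformly in \<open>m\<close>. This carries convergence from a
  dense set to the whole space and from a finite net to a precompact set.\<close>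

lemma norm_proj_diff_le: "norm (proj m x - x) \<le> norm (proj m y - y) + 2 * norm (y - x)"
proof -
  have "proj m x - x = (proj m y - y) + (y - x) - proj m (y - x)"
    by (simp add: blinfun.diff_right)
  then have "norm (proj m x - x) = norm ((proj m y - y) + (y - x) - proj m (y - x))"
    by (rule arg_cong)
  then show ?thesis
    using norm_triangle_ineq4[of "(proj m y - y) + (y - x)" "proj m (y - x)"]
      norm_triangle_ineq[of "proj m y - y" "y - x"] norm_proj_apply_le[of m "y - x"] by linarith
qed

text \<open>The vectors with convergence form a subspace that contains each basis vector, where the
  projections are eventually stationary. Density of the span and the uniform error bound then give
  all vectors.\<close>

lemma proj_tendsto: "(\<lambda>m. proj m x) \<longlonglongrightarrow> x"
proof -
  have "complex_vector.subspace {y. (\<lambda>m. proj m y) \<longlonglongrightarrow> y}"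
  proof (rule complex_vector.subspaceI)
    fix c y assume "y \<in> {y. (\<lambda>m. proj m y) \<longlonglongrightarrow> y}"
    then have "(\<lambda>m. c *\<^sub>C proj m y) \<longlonglongrightarrow> c *\<^sub>C y"
      using bounded_linear.tendsto[OF bounded_linear_scaleC_right] by blast
    then show "c *\<^sub>C y \<in> {y. (\<lambda>m. proj m y) \<longlonglongrightarrow> y}"
      using compact_ops_bounded[OF proj_compact_ops] by (simp add: bounded_ops_def)
  qed (auto simp: blinfun.add_right blinfun.zero_right intro: tendsto_add)
  moreover have "(\<lambda>m. proj m (e j)) \<longlonglongrightarrow> e j" if "1 \<le> j" for j
    using that proj_basis
    by (intro tendsto_eventually eventually_sequentiallyI[of j]) auto
  ultimately have span: "(\<lambda>m. proj m y) \<longlonglongrightarrow> y" if "y \<in> cspan (e ` {1..})" for y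
    using complex_vector.span_minimal[of "e ` {1..}" "{y. (\<lambda>m. proj m y) \<longlonglongrightarrow> y}"] that by auto
  show ?thesis
  proof (rule LIMSEQ_I)
    fix \<epsilon> :: real assume "\<epsilon> > 0"
    moreover have "x \<in> closure (cspan (e ` {1..}))"
      using basis by (simp add: orthonormal_basis_def)
    \<comment> \<open>One third of \<open>\<epsilon>\<close> is spent on the error at
      \<open>y\<close>, two thirds on the doubled distance from \<open>y\<close> to
      \<open>x\<close>.\<close>
    ultimately obtain y where y: "y \<in> cspan (e ` {1..})" "dist y x < \<epsilon> / 3"
      unfolding closure_approachable by (meson divide_pos_pos zero_less_numeral)
    obtain N where N: "norm (proj m y - y) < \<epsilon> / 3" if "m \<ge> N" for m
      using LIMSEQ_D[OF span[OF y(1)], of "\<epsilon> / 3"] \<open>\<epsilon> > 0\<close> by auto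
    have "norm (proj m x - x) < \<epsilon>" if "m \<ge> N" for m
      using norm_proj_diff_le[of m x y] N[OF that] y(2)[unfolded dist_norm] by linarith
    then show "\<exists>N. \<forall>m\<ge>N. norm (proj m x - x) < \<epsilon>" by blast
  qed
qed

text \<open>Pointwise convergence of contractions is uniform on precompact sets, in particular on
  the image of the unit ball under \<open>F\<close>.\<close>

lemma proj_compose_compact_tendsto:
  assumes "F \<in> compact_ops"
  shows "(\<lambda>m. proj m o\<^sub>L F) \<longlonglongrightarrow> F"
proof (rule LIMSEQ_I)
  fix \<epsilon> :: real assume \<epsilon>: "\<epsilon> > 0"
  then obtain k where k: "finite k" "blinfun_apply F ` cball 0 1 \<subseteq> (\<Union>y\<in>k. ball y (\<epsilon> / 4))"
    using compact_ops_finite_net[OF assms, of "\<epsilon> / 4"] by auto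
  have "\<forall>\<^sub>F m in sequentially. \<forall>y\<in>k. dist (proj m y) y < \<epsilon> / 4"
    using k(1) \<epsilon> tendstoD[OF proj_tendsto, of "\<epsilon> / 4"] by (simp add: eventually_ball_finite)
  then obtain N where N: "dist (proj m y) y < \<epsilon> / 4" if "m \<ge> N" "y \<in> k" for m y
    unfolding eventually_sequentially by blast
  have unit: "norm (proj m (F x) - F x) \<le> \<epsilon> * 3 / 4" if "m \<ge> N" "norm x = 1" for m x
  proof -
    have "F x \<in> blinfun_apply F ` cball 0 1" using that by simp
    then obtain y where y: "y \<in> k" "norm (y - F x) < \<epsilon> / 4"
      using k(2) unfolding subset_iff UN_iff mem_ball dist_norm by blast
    show ?thesis
      using N[OF that(1) y(1), unfolded dist_norm] y(2) norm_proj_diff_le[of m "F x" y] by linarith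
  qed
  \<comment> \<open>The pointwise estimate is kept strictly below \<open>\<epsilon>\<close>, because
    the passage to the operator norm only preserves weak inequalities.\<close>
  have lt: "\<epsilon> * 3 / 4 < \<epsilon>" using \<epsilon> by simp
  have "norm ((proj m o\<^sub>L F) - F) \<le> \<epsilon> * 3 / 4" if "m \<ge> N" for m
  proof (rule norm_blinfun_bound)
    fix x
    show "norm (((proj m o\<^sub>L F) - F) x) \<le> \<epsilon> * 3 / 4 * norm x"
    proof (cases "x = 0")
      case False
      define u where "u = x /\<^sub>R norm x"
      have "norm u = 1" and x: "x = norm x *\<^sub>R u" using False by (simp_all add: u_def)
      have "((proj m o\<^sub>L F) - F) x = norm x *\<^sub>R (proj m (F u) - F u)"
        by (subst x) (simp add: blinfun.diff_left blinfun.scaleR_right scaleR_diff_right)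
      then have "norm (((proj m o\<^sub>L F) - F) x) = norm (proj m (F u) - F u) * norm x"
        by simp
      also have "\<dots> \<le> \<epsilon> * 3 / 4 * norm x"
        by (rule mult_right_mono[OF unit[OF that \<open>norm u = 1\<close>]]) simp
      finally show ?thesis .
    qed (simp add: blinfun.zero_right)
  qed (use \<epsilon> in simp)
  then show "\<exists>N. \<forall>m\<ge>N. norm ((proj m o\<^sub>L F) - F) < \<epsilon>"
    using \<epsilon> by (metis (no_types, lifting) le_less_trans lt)
qed

section \<open>Square-summable coefficients and separability of the compact operators\<close>

lemma norm_sum_basis:
  assumes "finite A" "A \<subseteq> {1..}"
  shows "(norm (\<Sum>i\<in>A. c i *\<^sub>C e i))\<^sup>2 = (\<Sum>i\<in>A. (cmod (c i))\<^sup>2)"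
proof -
  let ?y = "\<Sum>i\<in>A. c i *\<^sub>C e i"
  have "cinner ?y ?y = (\<Sum>i\<in>A. cnj (c i) * cinner ?y (e i))"
    by (simp only: cinner_sum_right[of ?y] cinner_scaleC_right)
  also have "\<dots> = (\<Sum>i\<in>A. complex_of_real ((cmod (c i))\<^sup>2))"
    using assms by (intro sum.cong) (auto simp only: cinner_sum_basis[OF assms] subset_iff complex_norm_square mult.commute[of "cnj _"] atLeast_iff if_True)
  finally show ?thesis
    by (metis cinner_self of_real_eq_iff of_real_sum)
qed

lemma apply_sum_basis:
  assumes "F \<in> bounded_ops"
  shows "cinner (F (\<Sum>i\<in>A. c i *\<^sub>C e i)) b = (\<Sum>i\<in>A. c i * cinner (F (e i)) b)"
  using assms by (simp add: blinfun.sum_right bounded_ops_def cinner_sum_left cinner_scaleC_left)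

text \<open>Testing the functional \<open>x \<mapsto> \<langle>F x, b\<rangle>\<close> on \<open>\<Sum> cnj (a j) e j\<close>, where \<open>a j = \<langle>F (e j), b\<rangle>\<close>,
  shows that \<open>a\<close> is square summable; the tails of \<open>a\<close> bound the distance in norm.\<close>

lemma rank_one_compose_proj_tendsto:
  assumes F: "F \<in> bounded_ops"
  shows "(\<lambda>n. rank_one v b o\<^sub>L F o\<^sub>L proj n) \<longlonglongrightarrow> (rank_one v b o\<^sub>L F)"
proof -
  define a where "a j = cinner (F (e j)) b" for j
  define y where "y A = (\<Sum>j\<in>A. cnj (a j) *\<^sub>C e j)" for A
  have norm_y: "(norm (y A))\<^sup>2 = (\<Sum>j\<in>A. (cmod (a j))\<^sup>2)" if "finite A" "A \<subseteq> {1..}" for A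
    unfolding y_def norm_sum_basis[OF that] by simp
  have bound: "(\<Sum>j\<in>A. (cmod (a j))\<^sup>2) \<le> (norm F * norm b)\<^sup>2" if A: "finite A" "A \<subseteq> {1..}" for A
  proof (cases "norm (y A) = 0")
    case False
    have "cinner (F (y A)) b = (\<Sum>j\<in>A. complex_of_real ((cmod (a j))\<^sup>2))"
      unfolding y_def apply_sum_basis[OF F] a_def[symmetric]
      by (simp add: complex_norm_square mult.commute del: of_real_power)
    also have "\<dots> = complex_of_real ((norm (y A))\<^sup>2)"
      by (simp add: norm_y[OF A])
    finally have "(norm (y A))\<^sup>2 = cmod (cinner (F (y A)) b)"
      by (metis norm_of_real abs_of_nonneg zero_le_power2)
    also have "\<dots> \<le> norm (F (y A)) * norm b"
      by (rule Cauchy_Schwarz_cinner)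
    also have "\<dots> \<le> norm F * norm (y A) * norm b"
      by (intro mult_right_mono norm_blinfun) simp
    finally have "norm (y A) * norm (y A) \<le> (norm F * norm b) * norm (y A)"
      by (simp add: power2_eq_square mult_ac)
    then have "norm (y A) \<le> norm F * norm b"
      using False by simp
    then show ?thesis
      by (metis norm_y[OF A] norm_ge_zero power_mono)
  qed (use norm_y[OF A] in simp)
  have summable: "summable (\<lambda>j. (cmod (a (Suc j)))\<^sup>2)"
  proof (rule summableI_nonneg_bounded)
    show "(\<Sum>j<n. (cmod (a (Suc j)))\<^sup>2) \<le> (norm F * norm b)\<^sup>2" for n
      using bound[of "{1..n}"] by (simp add: sum.atLeast1_atMost_eq)
  qed simp
  show ?thesis
  proof (rule LIMSEQ_I)
    fix \<epsilon> :: real assume "\<epsilon> > 0"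
    \<comment> \<open>The denominator is positive even for \<open>v = 0\<close>, and
      \<open>\<delta> * norm v\<close> is strictly below \<open>\<epsilon>\<close>.\<close>
    define \<delta> where "\<delta> = \<epsilon> / (norm v + 1)"
    have \<delta>: "\<delta> > 0" using \<open>\<epsilon> > 0\<close> by (simp add: \<delta>_def add_nonneg_pos)
    have "\<delta>\<^sup>2 > 0" using \<delta> by simp
    then obtain N where N: "norm (\<Sum>j=m..n. (cmod (a (Suc j)))\<^sup>2) < \<delta>\<^sup>2" if "m \<ge> N" for m n
      using summable_partial_sum_bound[OF summable] by metis
    have norm_y_le: "norm (y {Suc m..n}) \<le> \<delta>" if "m \<ge> N" for m n
    proof (cases "m \<le> n")
      case True
      have "(norm (y {Suc m..n}))\<^sup>2 = (\<Sum>j\<in>{Suc m..n}. (cmod (a j))\<^sup>2)"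
        by (rule norm_y) auto
      \<comment> \<open>The basis starts at index 1, so the series was shifted by
        \<open>Suc\<close>, and its block from \<open>m\<close> to \<open>n\<close> ends at
        \<open>Suc n\<close> in the original indices. The extra term is nonnegative.\<close>
      also have "\<dots> \<le> (\<Sum>j\<in>{Suc m..Suc n}. (cmod (a j))\<^sup>2)"
        by (intro sum_mono2) auto
      also have "\<dots> = (\<Sum>j=m..n. (cmod (a (Suc j)))\<^sup>2)"
        by (rule sum.shift_bounds_cl_Suc_ivl)
      also have "\<dots> < \<delta>\<^sup>2"
        using N[OF that, of n] by simp
      finally show ?thesis
        using \<delta> by (simp add: power2_less_imp_less less_imp_le)
    qed (use \<delta> in \<open>simp add: y_def\<close>)
    have tail: "cmod (cinner (F (proj n x - proj m x)) b) \<le> \<delta> * norm x"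
      if "N \<le> m" "m \<le> n" for m n x
    proof -
      have "{1..n} = {1..m} \<union> {Suc m..n}" "{1..m} \<inter> {Suc m..n} = {}"
        using that by auto
      then have "proj n x - proj m x = (\<Sum>j\<in>{Suc m..n}. cinner x (e j) *\<^sub>C e j)"
        unfolding proj_apply by (simp add: sum.union_disjoint)
      then have "cinner (F (proj n x - proj m x)) b = (\<Sum>j\<in>{Suc m..n}. cinner x (e j) * a j)"
        unfolding a_def by (simp only: apply_sum_basis[OF F])
      also have "\<dots> = cinner x (y {Suc m..n})"
        by (simp add: y_def cinner_sum_right cinner_scaleC_right mult.commute)
      finally have "cmod (cinner (F (proj n x - proj m x)) b) \<le> norm x * norm (y {Suc m..n})"
        using Cauchy_Schwarz_cinner by metis
      also have "\<dots> \<le> norm x * \<delta>"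
        by (rule mult_left_mono[OF norm_y_le[OF that(1)]]) simp
      finally show ?thesis by (simp add: mult.commute)
    qed
    have "norm ((rank_one v b o\<^sub>L F o\<^sub>L proj m) - (rank_one v b o\<^sub>L F)) < \<epsilon>" if "m \<ge> N" for m
    proof -
      \<comment> \<open>The bound for finite blocks does not depend on \<open>n\<close>, so it
        survives the limit in which \<open>proj n x\<close> tends to \<open>x\<close>.\<close>
      have "cmod (cinner (F (x - proj m x)) b) \<le> \<delta> * norm x" for x
      proof (rule tendsto_upperbound)
        show "(\<lambda>n. cmod (cinner (F (proj n x - proj m x)) b))
          \<longlonglongrightarrow> cmod (cinner (F (x - proj m x)) b)"
          by (intro tendsto_norm bounded_linear.tendsto[OF bounded_linear_cinner_left]
              blinfun.tendsto tendsto_diff tendsto_const proj_tendsto)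
        show "\<forall>\<^sub>F n in sequentially. cmod (cinner (F (proj n x - proj m x)) b) \<le> \<delta> * norm x"
          using tail[OF that] by (rule eventually_sequentiallyI)
      qed simp
      moreover have "((rank_one v b o\<^sub>L F o\<^sub>L proj m) - (rank_one v b o\<^sub>L F)) x
          = - (cinner (F (x - proj m x)) b *\<^sub>C v)" for x
        by (simp add: blinfun.diff_left blinfun.diff_right cinner_diff_left
            complex_vector.scale_left_diff_distrib)
      ultimately have "norm ((rank_one v b o\<^sub>L F o\<^sub>L proj m) - (rank_one v b o\<^sub>L F)) \<le> \<delta> * norm v"
        using \<delta>
        by (intro norm_blinfun_bound)
          (simp_all add: norm_scaleC mult.assoc mult.commute[of _ "norm v"] mult_left_mono)
      also have "\<dots> < \<delta> * (norm v + 1)" using \<delta> by simp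
      also have "\<dots> = \<epsilon>"
        using norm_ge_zero[of v] by (simp add: \<delta>_def add_nonneg_eq_0_iff)
      finally show ?thesis .
    qed
    then show "\<exists>N. \<forall>m\<ge>N. norm ((rank_one v b o\<^sub>L F o\<^sub>L proj m) - (rank_one v b o\<^sub>L F)) < \<epsilon>"
      by blast
  qed
qed

text \<open>The compressions \<open>P m F P n\<close> are finite matrices, approximable by matrices
  with entries in a countable dense set of scalars. Letting \<open>n\<close> and then
  \<open>m\<close> tend to infinity recovers \<open>F\<close> in norm.\<close>

lemma separable_compact_ops:
  obtains C :: "('a \<Rightarrow>\<^sub>L 'a) set" where "countable C" "compact_ops \<subseteq> closure C"
proof -
  obtain Q :: "complex set" where Q: "countable Q" "\<And>X. open X \<Longrightarrow> X \<noteq> {} \<Longrightarrow> \<exists>d\<in>Q. d \<in> X"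
    using countable_dense_setE by blast
  define B where "B = (\<lambda>(d, i, j). rank_one (d *\<^sub>C e i) (e j)) ` (Q \<times> (UNIV :: (nat \<times> nat) set))"
  \<comment> \<open>Lists represent finite sums with repetition; concatenation makes
    \<open>C\<close>, and hence its closure, stable under addition.\<close>
  define C where "C = sum_list ` lists B"
  have "countable C"
    unfolding C_def B_def using Q(1) by (intro countable_image countable_lists countable_SIGMA) auto
  moreover have "compact_ops \<subseteq> closure C"
  proof
    have zero: "0 \<in> closure C"
      using closure_subset[of C] by (force simp: C_def intro: image_eqI[of _ _ "[]"])
    have add: "x + y \<in> closure C" if "x \<in> closure C" "y \<in> closure C" for x y
    proof -
      have "C + C \<subseteq> C"
      proof
        fix z assume "z \<in> C + C"
        then obtain xs ys where "xs \<in> lists B" "ys \<in> lists B" "z = sum_list xs + sum_list ys"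
          unfolding C_def by (elim set_plus_elim imageE) blast
        then show "z \<in> C"
          unfolding C_def by (intro image_eqI[of _ _ "xs @ ys"]) simp_all
      qed
      then show ?thesis
        using closure_sum[of C C] closure_mono[of "C + C" C] that set_plus_intro by blast
    qed
    have sum: "sum f A \<in> closure C" if "\<And>i. i \<in> A \<Longrightarrow> f i \<in> closure C" for A :: "nat set" and f
      using that by (induction A rule: infinite_finite_induct) (auto simp: zero add)
    have scaled: "rank_one (c *\<^sub>C e i) (e j) \<in> closure C" if "1 \<le> i" "1 \<le> j" for c i j
      unfolding closure_approachable
    proof (intro allI impI)
      fix \<epsilon> :: real assume "\<epsilon> > 0"
      then obtain d where d: "d \<in> Q" "d \<in> ball c \<epsilon>"
        using Q(2)[of "ball c \<epsilon>"] by auto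
      have "norm (rank_one (d *\<^sub>C e i) (e j) - rank_one (c *\<^sub>C e i) (e j))
          \<le> norm (d *\<^sub>C e i - c *\<^sub>C e i) * norm (e j)"
        unfolding rank_one_diff_left by (rule norm_rank_one_le)
      also have "\<dots> < \<epsilon>"
        using that d by (simp add: norm_basis norm_scaleC dist_norm norm_minus_commute
            flip: complex_vector.scale_left_diff_distrib)
      finally have "dist (rank_one (d *\<^sub>C e i) (e j)) (rank_one (c *\<^sub>C e i) (e j)) < \<epsilon>"
        by (simp add: dist_norm)
      moreover have "rank_one (d *\<^sub>C e i) (e j) \<in> C"
        unfolding C_def using d(1)
        by (intro image_eqI[of _ _ "[rank_one (d *\<^sub>C e i) (e j)]"])
          (simp_all add: B_def image_iff, blast)
      ultimately show "\<exists>y\<in>C. dist y (rank_one (c *\<^sub>C e i) (e j)) < \<epsilon>" by blast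
    qed
    fix F :: "'a \<Rightarrow>\<^sub>L 'a" assume F: "F \<in> compact_ops"
    note F' = compact_ops_bounded[OF F]
    have "proj m o\<^sub>L F o\<^sub>L proj n \<in> closure C" for m n
    proof -
      have "proj m o\<^sub>L F o\<^sub>L proj n
          = (\<Sum>i = 1..m. \<Sum>j = 1..n. rank_one (cinner (F (e j)) (e i) *\<^sub>C e i) (e j))"
        by (rule blinfun_eqI)
          (simp add: blinfun_apply_sum proj_apply[of m] proj_apply[of n] apply_sum_basis[OF F']
            scaleC_scaleC complex_vector.scale_sum_left)
      then show ?thesis
        by (auto intro!: sum scaled)
    qed
    moreover have "(\<lambda>n. proj m o\<^sub>L F o\<^sub>L proj n) \<longlonglongrightarrow> (proj m o\<^sub>L F)" for m
    proof -
      \<comment> \<open>\<open>proj m\<close> is a finite sum of rank-one operators, so convergence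
        in \<open>n\<close> follows row by row from the rank-one case.\<close>
      have "(\<lambda>n. \<Sum>i = 1..m. rank_one (e i) (e i) o\<^sub>L F o\<^sub>L proj n)
          \<longlonglongrightarrow> (\<Sum>i = 1..m. rank_one (e i) (e i) o\<^sub>L F)"
        by (intro tendsto_sum rank_one_compose_proj_tendsto F')
      moreover have "(\<Sum>i = 1..m. rank_one (e i) (e i) o\<^sub>L A) = proj m o\<^sub>L A" for A :: "'a \<Rightarrow>\<^sub>L 'a"
        by (rule blinfun_eqI) (simp add: blinfun_apply_sum proj_apply)
      moreover have "(\<Sum>i = 1..m. rank_one (e i) (e i) o\<^sub>L F o\<^sub>L A) = proj m o\<^sub>L F o\<^sub>L A" for A :: "'a \<Rightarrow>\<^sub>L 'a"
        by (rule blinfun_eqI) (simp add: blinfun_apply_sum proj_apply)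
      ultimately show ?thesis by (simp only:)
    qed
    ultimately have "proj m o\<^sub>L F \<in> closure C" for m
      by (rule closed_sequentially[OF closed_closure])
    then show "F \<in> closure C"
      by (rule closed_sequentially[OF closed_closure _ proj_compose_compact_tendsto[OF F]])
  qed
  ultimately show ?thesis
    using that by blast
qed

end

subsection \<open>Powers of operators\<close>

lemma op_power_apply: "blinfun_apply (op_power W n) x = (blinfun_apply W ^^ n) x"
  by (induction n) (simp_all add: op_power_def)

lemma op_power_bounded_ops: "W \<in> bounded_ops \<Longrightarrow> op_power W n \<in> bounded_ops"
  by (induction n) (simp_all add: op_power_def bounded_ops_id bounded_ops_blinfun_compose)



lemma op_power_inverse:
  assumes "V o\<^sub>L W = id_blinfun"
  shows "op_power V n (op_power W n x) = x"
proof (induction n)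
  case (Suc n)
  have "V (W y) = y" for y
    using assms by (metis blinfun_apply_blinfun_compose blinfun_apply_id_blinfun id_apply)
  \<comment> \<open>The innermost factor of the power of \<open>V\<close> is placed next to the
    outermost factor of the power of \<open>W\<close>; they cancel, and the induction hypothesis
    handles the rest.\<close>
  then show ?case
    using Suc by (simp add: op_power_apply funpow_Suc_right del: funpow.simps(2))
      (simp add: funpow_swap1[of W, symmetric])
qed (simp add: op_power_def)

lemma elem_op_funpow: "(elem_op U W ^^ n) F = op_power W n o\<^sub>L F o\<^sub>L op_power U n"
  by (induction n) (auto intro!: blinfun_eqI simp: elem_op_def op_power_apply funpow_swap1)

lemma elem_op_compact_ops:
  "U \<in> bounded_ops \<Longrightarrow> W \<in> bounded_ops \<Longrightarrow> F \<in> compact_ops \<Longrightarrow> elem_op U W F \<in> compact_ops"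
  unfolding elem_op_def by (intro compact_ops_compose_right compact_ops_compose_left)

lemma norm_op_power_isometry:
  fixes U :: "'a::complex_inner \<Rightarrow>\<^sub>L 'a"
  shows "(\<And>x. norm (U x) = norm x) \<Longrightarrow> norm (op_power U n x) = norm x"
  by (induction n) (simp_all add: op_power_apply)

lemma cinner_op_power_isometry:
  fixes U :: "'a::complex_inner \<Rightarrow>\<^sub>L 'a"
  shows "(\<And>x y. cinner (U x) (U y) = cinner x y) \<Longrightarrow>
    cinner (op_power U n x) (op_power U n y) = cinner x y"
  by (induction n) (simp_all add: op_power_apply)

lemma norm_compose_contraction_le:
  fixes A :: "'b::real_normed_vector \<Rightarrow>\<^sub>L 'c::real_normed_vector"
    and B :: "'a::real_normed_vector \<Rightarrow>\<^sub>L 'b"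
  assumes "\<And>x. norm (B x) \<le> norm x"
  shows "norm (A o\<^sub>L B) \<le> norm A"
proof -
  have "norm B \<le> 1"
    using assms by (intro norm_blinfun_bound) simp_all
  then show ?thesis
    using norm_blinfun_compose[of A B] mult_left_mono[of "norm B" 1 "norm A"] by simp
qed

section \<open>Hypercyclicity and collapse of perturbed projections\<close>

locale invertible_unitary_pair = orthonormal_sequence e
  for e :: "nat \<Rightarrow> 'a::chilbert_space" +
  fixes U U' W W' :: "'a \<Rightarrow>\<^sub>L 'a"
  assumes bounded: "U \<in> bounded_ops" "U' \<in> bounded_ops" "W \<in> bounded_ops" "W' \<in> bounded_ops"
    and inverse_U: "U' o\<^sub>L U = id_blinfun" "U o\<^sub>L U' = id_blinfun"
    and inverse_W: "W' o\<^sub>L W = id_blinfun" "W o\<^sub>L W' = id_blinfun"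
    and cinner_U: "\<And>x y. cinner (U x) (U y) = cinner x y"
begin

lemma norm_U: "norm (U x) = norm x" and norm_U': "norm (U' x) = norm x"
proof -
  show "norm (U x) = norm x" for x
    by (simp add: norm_eq_sqrt_cinner cinner_U)
  then show "norm (U' x) = norm x"
    using inverse_U(2) by (metis blinfun_apply_blinfun_compose blinfun_apply_id_blinfun id_apply)
qed

lemmas power_inverse =
  op_power_inverse[OF inverse_U(1)] op_power_inverse[OF inverse_U(2)]
  op_power_inverse[OF inverse_W(1)] op_power_inverse[OF inverse_W(2)]

lemma norm_compose_powers_le:
  "norm (A o\<^sub>L op_power U n) \<le> norm A" "norm (A o\<^sub>L op_power U' n) \<le> norm A"
  "norm (A o\<^sub>L proj m) \<le> norm A"
  using norm_op_power_isometry[of U] norm_op_power_isometry[of U'] norm_U norm_U'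
  by (intro norm_compose_contraction_le; simp add: norm_proj_apply_le)+

text \<open>One stage of the sequential condition: time \<open>n\<close>, precision
  \<open>\<epsilon>\<close>. Sequences are assembled from such stages afterwards.\<close>

definition collapsing :: "nat \<Rightarrow> nat \<Rightarrow> real \<Rightarrow> ('a \<Rightarrow>\<^sub>L 'a) \<Rightarrow> ('a \<Rightarrow>\<^sub>L 'a) \<Rightarrow> bool"
  where "collapsing m n \<epsilon> D G \<longleftrightarrow> D \<in> compact_ops \<and> G \<in> compact_ops \<and>
    norm (D - proj m) < \<epsilon> \<and> norm (G - proj m) < \<epsilon> \<and>
    norm (op_power W n o\<^sub>L G) < \<epsilon> \<and> norm (op_power W' n o\<^sub>L D) < \<epsilon>"

text \<open>The orthogonality hypothesis survives raising \<open>N\<close>, so arbitrarily late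
  times \<open>n\<close> are available and can be arranged into an increasing sequence.\<close>

lemma collapsing_if_hypercyclic:
  assumes hyp: "hypercyclic_on compact_ops (elem_op U W)" and m: "m \<ge> 1" and \<epsilon>: "\<epsilon> > 0"
    and orth: "\<And>n. n \<ge> N \<Longrightarrow>
      orthogonal_sets (op_power U n ` cspan (e ` {1..m})) (cspan (e ` {1..m}))"
  shows "\<exists>n\<ge>N. \<exists>D G. collapsing m n \<epsilon> D G"
proof -
  let ?T = "elem_op U W" and ?P = "proj m" and ?L = "cspan (e ` {1..m})"
  obtain F where F: "F \<in> compact_ops" "compact_ops \<subseteq> closure {(?T ^^ n) F | n. True}"
    using hyp by (auto simp: hypercyclic_on_def)
  have orbit: "(?T ^^ n) F \<in> compact_ops" for n
    by (induction n) (simp_all add: F elem_op_compact_ops bounded)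
  have "?P \<noteq> 0"
    using proj_basis[of 1 m] norm_basis[of 1] m by auto
  then have inf: "infinite {n. dist ((?T ^^ n) F) ?P < \<epsilon>}"
    using F \<epsilon> by (intro hypercyclic_orbit_infinitely_close[of compact_ops])
      (auto intro: compact_ops_scaleR proj_compact_ops)
  obtain i where i: "dist ((?T ^^ i) F) ?P < \<epsilon>"
    using inf infinite_imp_nonempty by blast
  \<comment> \<open>The gap between the two return times exceeds \<open>N\<close>, which puts the
    difference \<open>n\<close> in the range where orthogonality holds.\<close>
  obtain j where j: "j > i + N" "dist ((?T ^^ j) F) ?P < \<epsilon>"
    using inf unfolding infinite_nat_iff_unbounded by blast
  define n where "n = j - i"
  have n: "n \<ge> N" "j = n + i" using j by (auto simp: n_def)
  define A B where "A = (?T ^^ i) F" and "B = (?T ^^ j) F"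
  have AB: "B = op_power W n o\<^sub>L A o\<^sub>L op_power U n"
    by (simp only: A_def B_def n(2) funpow_add o_apply elem_op_funpow)
  have PU: "?P (op_power U n (?P x)) = 0" for x
    using orth[OF n(1)] proj_in_span by (intro proj_eq_0) (auto simp: orthogonal_sets_def)
  \<comment> \<open>Isometry moves the power of \<open>U'\<close> to the other argument as a power
    of \<open>U\<close>, which reduces the claim to the same orthogonality.\<close>
  have PU': "?P (op_power U' n (?P x)) = 0" for x
  proof (rule proj_eq_0)
    fix y assume y: "y \<in> ?L"
    have "cinner (op_power U' n (?P x)) y = cinner (?P x) (op_power U n y)"
      using cinner_op_power_isometry[of U n "op_power U' n (?P x)" y]
      by (simp add: cinner_U power_inverse)
    also have "\<dots> = 0"
      using orth[OF n(1)] y proj_in_span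
      by (subst cinner_eq_zero_commute) (auto simp: orthogonal_sets_def)
    finally show "cinner (op_power U' n (?P x)) y = 0" .
  qed
  have near: "norm ((C o\<^sub>L ?P) - ?P) < \<epsilon>" if "dist C ?P < \<epsilon>" for C
  proof -
    have "(C o\<^sub>L ?P) - ?P = (C - ?P) o\<^sub>L ?P"
      by (rule blinfun_eqI) (simp add: blinfun.diff_left proj_proj)
    then show ?thesis
      using norm_compose_powers_le(3)[of "C - ?P" m] that by (simp add: dist_norm)
  qed
  \<comment> \<open>From \<open>AB\<close>, \<open>W^n A = B U^(-n)\<close>; subtracting
    \<open>P U^(-n) P = 0\<close> replaces \<open>B\<close> by the small difference
    \<open>B - P\<close>. The estimate for \<open>W'\<close> below is symmetric.\<close>
  have "op_power W n o\<^sub>L (A o\<^sub>L ?P) = (B - ?P) o\<^sub>L op_power U' n o\<^sub>L ?P"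
    by (rule blinfun_eqI) (simp add: blinfun.diff_left PU' AB power_inverse)
  then have "norm (op_power W n o\<^sub>L (A o\<^sub>L ?P)) \<le> norm (B - ?P)"
    using norm_compose_powers_le order_trans by metis
  moreover have "op_power W' n o\<^sub>L (B o\<^sub>L ?P) = (A - ?P) o\<^sub>L op_power U n o\<^sub>L ?P"
    by (rule blinfun_eqI) (simp add: blinfun.diff_left PU AB power_inverse)
  then have "norm (op_power W' n o\<^sub>L (B o\<^sub>L ?P)) \<le> norm (A - ?P)"
    using norm_compose_powers_le order_trans by metis
  moreover have "A o\<^sub>L ?P \<in> compact_ops" "B o\<^sub>L ?P \<in> compact_ops"
    using orbit compact_ops_bounded[OF proj_compact_ops]
    by (auto simp: A_def B_def intro: compact_ops_compose_right)
  ultimately have "collapsing m n \<epsilon> (B o\<^sub>L ?P) (A o\<^sub>L ?P)"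
    using i j(2) near unfolding collapsing_def A_def[symmetric] B_def[symmetric] dist_norm
    by auto
  then show ?thesis
    using n by blast
qed

lemma hypercyclic_if_collapsing:
  assumes collapse: "\<And>m. m \<ge> 1 \<Longrightarrow> \<exists>(n :: nat \<Rightarrow> nat) D G.
      (\<forall>k. D k \<in> compact_ops) \<and> (\<forall>k. G k \<in> compact_ops) \<and>
      D \<longlonglongrightarrow> proj m \<and> G \<longlonglongrightarrow> proj m \<and>
      (\<lambda>k. op_power W (n k) o\<^sub>L G k) \<longlonglongrightarrow> 0 \<and> (\<lambda>k. op_power W' (n k) o\<^sub>L D k) \<longlonglongrightarrow> 0"
  shows "hypercyclic_on compact_ops (elem_op U W)"
proof -
  let ?T = "elem_op U W"
  obtain C :: "('a \<Rightarrow>\<^sub>L 'a) set" where C: "countable C" "compact_ops \<subseteq> closure C"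
    using separable_compact_ops .
  show ?thesis
  proof (rule Birkhoff_transitivity[OF closed_compact_ops _ _ _ C])
    show "(compact_ops :: ('a \<Rightarrow>\<^sub>L 'a) set) \<noteq> {}"
      using compact_ops_zero by blast
    show "continuous_on compact_ops ?T"
      unfolding elem_op_def by (intro continuous_intros)
    show "?T ` compact_ops \<subseteq> compact_ops"
      using elem_op_compact_ops bounded by blast
    fix F H :: "'a \<Rightarrow>\<^sub>L 'a" and \<epsilon> :: real
    assume F: "F \<in> compact_ops" and H: "H \<in> compact_ops" and \<epsilon>: "\<epsilon> > 0"
    \<comment> \<open>\<open>m\<close> is fixed first, since the collapsing sequences depend on it;
      half of \<open>\<epsilon>\<close> pays for replacing \<open>F\<close> and \<open>H\<close> by
      their projections.\<close>
    have "\<forall>\<^sub>F m in sequentially. m \<ge> 1 \<and> dist (proj m o\<^sub>L F) F < \<epsilon> / 2 \<and> dist (proj m o\<^sub>L H) H < \<epsilon> / 2"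
      using \<epsilon> F H
      by (intro eventually_conj eventually_ge_at_top tendstoD proj_compose_compact_tendsto) auto
    then obtain m where m: "m \<ge> 1" "dist (proj m o\<^sub>L F) F < \<epsilon> / 2" "dist (proj m o\<^sub>L H) H < \<epsilon> / 2"
      unfolding eventually_sequentially by blast
    obtain n :: "nat \<Rightarrow> nat" and D G where
      D: "\<And>k. D k \<in> compact_ops" "D \<longlonglongrightarrow> proj m" "(\<lambda>k. op_power W' (n k) o\<^sub>L D k) \<longlonglongrightarrow> 0" and
      G: "\<And>k. G k \<in> compact_ops" "G \<longlonglongrightarrow> proj m" "(\<lambda>k. op_power W (n k) o\<^sub>L G k) \<longlonglongrightarrow> 0"
      using collapse[OF m(1)] by blast
    \<comment> \<open>\<open>Y k\<close> is the preimage of \<open>D k o H\<close> under the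
      \<open>n k\<close>-th iterate, and \<open>Z k\<close> is the image of \<open>G k o F\<close>
      under it. Both tend to 0, because the right factors \<open>U^n\<close> and
      \<open>U^(-n)\<close> do not enlarge norms.\<close>
    define Y where "Y k = op_power W' (n k) o\<^sub>L D k o\<^sub>L H o\<^sub>L op_power U' (n k)" for k
    define Z where "Z k = op_power W (n k) o\<^sub>L G k o\<^sub>L F o\<^sub>L op_power U (n k)" for k
    define X where "X k = (G k o\<^sub>L F) + Y k" for k
    have X: "X k \<in> compact_ops" for k
      unfolding X_def Y_def
      by (intro compact_ops_add compact_ops_compose_right[OF op_power_bounded_ops]
          compact_ops_compose_left bounded_ops_blinfun_compose op_power_bounded_ops bounded F H
          compact_ops_bounded[OF D(1)] compact_ops_bounded[OF G(1)])
    have TX: "(?T ^^ n k) (X k) = Z k + (D k o\<^sub>L H)" for k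
      by (rule blinfun_eqI)
        (simp add: elem_op_funpow X_def Y_def Z_def blinfun.add_left blinfun.add_right power_inverse)
    have Y0: "Y \<longlonglongrightarrow> 0"
    proof (rule Lim_null_comparison)
      show "(\<lambda>k. norm (op_power W' (n k) o\<^sub>L D k) * norm H) \<longlonglongrightarrow> 0"
        by (intro tendsto_mult_left_zero tendsto_norm_zero D(3))
      show "\<forall>\<^sub>F k in sequentially. norm (Y k) \<le> norm (op_power W' (n k) o\<^sub>L D k) * norm H"
        unfolding Y_def
        by (intro always_eventually allI order_trans[OF norm_compose_powers_le(2) norm_blinfun_compose])
    qed
    have Z0: "Z \<longlonglongrightarrow> 0"
    proof (rule Lim_null_comparison)
      show "(\<lambda>k. norm (op_power W (n k) o\<^sub>L G k) * norm F) \<longlonglongrightarrow> 0"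
        by (intro tendsto_mult_left_zero tendsto_norm_zero G(3))
      show "\<forall>\<^sub>F k in sequentially. norm (Z k) \<le> norm (op_power W (n k) o\<^sub>L G k) * norm F"
        unfolding Z_def
        by (intro always_eventually allI order_trans[OF norm_compose_powers_le(1) norm_blinfun_compose])
    qed
    have "(\<lambda>k. G k o\<^sub>L F) \<longlonglongrightarrow> (proj m o\<^sub>L F)" "(\<lambda>k. D k o\<^sub>L H) \<longlonglongrightarrow> (proj m o\<^sub>L H)"
      by (intro bounded_bilinear.tendsto[OF bounded_bilinear_blinfun_compose] D G tendsto_const)+
    from tendsto_add[OF this(1) Y0] tendsto_add[OF Z0 this(2)]
    have "X \<longlonglongrightarrow> (proj m o\<^sub>L F)" "(\<lambda>k. Z k + (D k o\<^sub>L H)) \<longlonglongrightarrow> (proj m o\<^sub>L H)"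
      by (simp_all add: X_def[abs_def])
    then have "\<forall>\<^sub>F k in sequentially. dist (X k) (proj m o\<^sub>L F) < \<epsilon> / 2 \<and>
        dist (Z k + (D k o\<^sub>L H)) (proj m o\<^sub>L H) < \<epsilon> / 2"
      using \<epsilon> by (intro eventually_conj tendstoD) auto
    then obtain k where k: "dist (X k) (proj m o\<^sub>L F) < \<epsilon> / 2"
      "dist ((?T ^^ n k) (X k)) (proj m o\<^sub>L H) < \<epsilon> / 2"
      unfolding eventually_sequentially TX by blast
    have "dist (X k) F < \<epsilon>" "dist ((?T ^^ n k) (X k)) H < \<epsilon>"
      using k m(2,3) dist_triangle[of "X k" F "proj m o\<^sub>L F"]
        dist_triangle[of "(?T ^^ n k) (X k)" H "proj m o\<^sub>L H"]
      by linarith+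
    then show "\<exists>z\<in>compact_ops. \<exists>n. dist z F < \<epsilon> \<and> dist ((?T ^^ n) z) H < \<epsilon>"
      using X by blast
  qed
qed

end

section \<open>Equivalence of hypercyclicity and the sequential condition\<close>

theorem theorem3p2:
  fixes e :: "nat \<Rightarrow> 'a::chilbert_space"
    and L :: "nat \<Rightarrow> 'a set"
    and P :: "nat \<Rightarrow> 'a \<Rightarrow>\<^sub>L 'a"
    and U W :: "'a \<Rightarrow>\<^sub>L 'a"
  assumes e: "orthonormal_basis {1..} e"
    and L: "\<And>k. L k = cspan (e ` {1..k})"
    and P: "\<And>m. P m = orthogonal_projection (L m)"
    and W: "W \<in> bounded_ops" "invertible_op W"
    and U: "unitary_op U"
    and U_orth: "\<And>k. k \<ge> 1 \<Longrightarrow>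
      \<exists>N\<ge>1. \<forall>n\<ge>N. orthogonal_sets (op_power U n ` L k) (L k)"
  shows "hypercyclic_on compact_ops (elem_op U W) \<longleftrightarrow>
    (\<forall>m\<ge>1. \<exists>(n :: nat \<Rightarrow> nat) D G.
      strict_mono n \<and> (\<forall>k. n k \<ge> 1) \<and>
      (\<forall>k. D k \<in> compact_ops) \<and> (\<forall>k. G k \<in> compact_ops) \<and>
      (\<lambda>k. norm (D k - P m)) \<longlonglongrightarrow> 0 \<and>
      (\<lambda>k. norm (G k - P m)) \<longlonglongrightarrow> 0 \<and>
      (\<lambda>k. norm (op_power W (n k) o\<^sub>L G k)) \<longlonglongrightarrow> 0 \<and>
      (\<lambda>k. norm (op_power (inverse_op W) (n k) o\<^sub>L D k)) \<longlonglongrightarrow> 0)"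
    (is "?hyp \<longleftrightarrow> (\<forall>m\<ge>1. \<exists>n D G. ?seq m n D G)")
proof -
  define W' where "W' = inverse_op W"
  have W': "W' \<in> bounded_ops" "W' o\<^sub>L W = id_blinfun" "W o\<^sub>L W' = id_blinfun"
    using is_inverse_op_inverse_op[OF W(2)] by (auto simp: is_inverse_op_def W'_def)
  obtain U' where U': "U' \<in> bounded_ops" "U' o\<^sub>L U = id_blinfun" "U o\<^sub>L U' = id_blinfun"
    "\<And>x y. cinner (U x) y = cinner x (U' y)"
    using U by (auto simp: unitary_op_def is_adjoint_op_def)
  have "cinner (U x) (U y) = cinner x y" for x y
    using U'(2,4) by (metis blinfun_apply_blinfun_compose blinfun_apply_id_blinfun id_apply)
  then interpret invertible_unitary_pair e U U' W W'
    using e U W W' U' by unfold_locales (auto simp: unitary_op_def)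
  have P_eq: "P m = proj m" for m
    by (simp add: P L proj_def)
  show ?thesis
  proof
    assume hyp: ?hyp
    show "\<forall>m\<ge>1. \<exists>n D G. ?seq m n D G"
    proof (intro allI impI)
      fix m :: nat assume m: "m \<ge> 1"
      obtain N where N: "N \<ge> 1" "\<And>n. n \<ge> N \<Longrightarrow>
          orthogonal_sets (op_power U n ` cspan (e ` {1..m})) (cspan (e ` {1..m}))"
        using U_orth[OF m] by (auto simp: L)
      \<comment> \<open>Times beyond \<open>max N M\<close> meet the orthogonality threshold and the
        demand to reach \<open>M\<close>; positivity comes from \<open>N \<ge> 1\<close>.\<close>
      have ex: "\<exists>n\<ge>M. n \<ge> 1 \<and> (\<exists>D G. collapsing m n \<epsilon> D G)" if "\<epsilon> > 0" for \<epsilon> M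
      proof -
        have "\<exists>n\<ge>max N M. \<exists>D G. collapsing m n \<epsilon> D G"
          using N by (intro collapsing_if_hypercyclic[OF hyp m that]) auto
        with N(1) show ?thesis
          by (meson max.boundedE order_trans)
      qed
      \<comment> \<open>Dependent choice takes precision \<open>1 / (k + 1)\<close> at stage
        \<open>k\<close> and forces each time beyond the previous one.\<close>
      have "\<exists>n. \<forall>k. (n k \<ge> 1 \<and> (\<exists>D G. collapsing m (n k) (inverse (real (Suc k))) D G)) \<and>
          n k < n (Suc k)"
      proof (rule dependent_nat_choice)
        show "\<exists>n. n \<ge> 1 \<and> (\<exists>D G. collapsing m n (inverse (real (Suc 0))) D G)"
          using ex[of "inverse (real (Suc 0))" 0] by auto
        show "\<exists>n'. (n' \<ge> 1 \<and> (\<exists>D G. collapsing m n' (inverse (real (Suc (Suc k)))) D G)) \<and> n < n'"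
          for n k
          using ex[of "inverse (real (Suc (Suc k)))" "Suc n"] by (auto simp: Suc_le_eq)
      qed
      then obtain n D G where n: "\<And>k. n k \<ge> 1" "\<And>k. n k < n (Suc k)"
        and DG: "\<And>k. collapsing m (n k) (inverse (real (Suc k))) (D k) (G k)"
        by metis
      have lim: "(\<lambda>k. norm (f k)) \<longlonglongrightarrow> 0" if "\<And>k. norm (f k) < inverse (real (Suc k))"
        for f :: "nat \<Rightarrow> 'a \<Rightarrow>\<^sub>L 'a"
        by (rule tendsto_sandwich[OF _ _ tendsto_const LIMSEQ_inverse_real_of_nat])
          (use that less_imp_le in \<open>auto intro!: always_eventually\<close>)
      have "?seq m n D G"
        using n DG unfolding collapsing_def P_eq W'_def[symmetric]
        by (auto simp: strict_mono_Suc_iff intro!: lim)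
      then show "\<exists>n D G. ?seq m n D G" by blast
    qed
  next
    assume seq: "\<forall>m\<ge>1. \<exists>n D G. ?seq m n D G"
    \<comment> \<open>Norms tending to 0 are restated as limits in the operator norm, the form
      required by the transitivity argument.\<close>
    show ?hyp
      using seq unfolding P_eq W'_def[symmetric] tendsto_norm_zero_iff LIM_zero_iff
      by (intro hypercyclic_if_collapsing) blast
  qed
qed

end
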